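(* There exists a constant $C>0$ such that for all sufficiently large $n$, $$f_3(n) \ge \Big(1+\frac15\Big)\binom{n-1}{2} - Cn.$$
   Context: For $\ell \ge 4$, the tight $3$-uniform $\ell$-cycle $TC_\ell^3$ is the $3$-uniform hypergraph on $\ell$ distinct vertices $v_0,\dots,v_{\ell-1}$ with edges $\{v_i,v_{i+1},v_{i+2}\}$ (subscripts mod $\ell$). A $3$-uniform hypergraph is tight-cycle-free if it contains no subhypergraph isomorphic to $TC_\ell^3$ for any $\ell\ge 4$. $f_3(n)$ denotes the maximum number of edges in a tight-cycle-free $3$-uniform hypergraph on $n$ vertices. *)

theory Defs
  imports Complex_Main
begin

type_synonym 'a hypergraph = "'a set \<times> 'a set set"

definition uniform_hypergraph :: "nat \<Rightarrow> 'a hypergraph \<Rightarrow> bool" where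
  "uniform_hypergraph k G \<longleftrightarrow> finite (fst G) \<and> (\<forall>e\<in>snd G. e \<subseteq> fst G \<and> card e = k)"

definition subhypergraph :: "'a hypergraph \<Rightarrow> 'a hypergraph \<Rightarrow> bool" where
  "subhypergraph H G \<longleftrightarrow>
     fst H \<subseteq> fst G \<and> snd H \<subseteq> snd G \<and> (\<forall>e\<in>snd H. e \<subseteq> fst H)"

definition hypergraph_iso :: "'a hypergraph \<Rightarrow> 'b hypergraph \<Rightarrow> bool" where
  "hypergraph_iso H H' \<longleftrightarrow>
     (\<exists>\<phi>. bij_betw \<phi> (fst H) (fst H') \<and> snd H' = (\<lambda>e. \<phi> ` e) ` snd H)"

definition tight_cycle :: "nat \<Rightarrow> nat hypergraph" where
  "tight_cycle l = ({..<l}, {{i, (i + 1) mod l, (i + 2) mod l} | i. i < l})"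

definition tight_cycle_free :: "'a hypergraph \<Rightarrow> bool" where
  "tight_cycle_free G \<longleftrightarrow>
     (\<forall>l\<ge>4. \<not> (\<exists>H. subhypergraph H G \<and> hypergraph_iso (tight_cycle l) H))"

text \<open>Both 3-uniformity and tight-cycle-freeness are invariant under relabelling, so hypergraphs
  on \<open>n\<close> vertices are represented on the vertex set \<open>{..<n}\<close>.\<close>

definition f3 :: "nat \<Rightarrow> nat" where
  "f3 n = Max {card E | E.
     uniform_hypergraph 3 ({..<n}, E) \<and> tight_cycle_free ({..<n}, E)}"

text \<open>The maximum is taken over a finite nonempty set, so \<open>Max\<close> is meaningful for every \<open>n\<close>.\<close>

lemma f3_well_defined:
  fixes n :: nat
  defines "S \<equiv> {card E | E. uniform_hypergraph 3 ({..<n}, E) \<and> tight_cycle_free ({..<n}, E)}"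
  shows "finite S" "S \<noteq> {}"
proof -
  have "S \<subseteq> card ` Pow (Pow {..<n})"
    unfolding S_def uniform_hypergraph_def by auto
  then show "finite S"
    by (rule finite_subset) simp
  have "tight_cycle_free ({..<n}, {})"
  proof -
    have "snd (tight_cycle l) \<noteq> {}" if "l \<ge> 4" for l
      using that by (auto simp: tight_cycle_def intro!: exI[of _ 0])
    then show ?thesis
      unfolding tight_cycle_free_def hypergraph_iso_def subhypergraph_def by fastforce
  qed
  then show "S \<noteq> {}"
    unfolding S_def uniform_hypergraph_def by auto
qed

end

theory Submission
  imports Defs "HOL-Number_Theory.Cong"
begin

text \<open>Fix a vertex \<open>v\<close> and split the pairs of the remaining vertices into blocks, any two of which
  share at most one vertex. If every block \<open>B\<close> carries a tight-cycle-free \<open>3\<close>-graph on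
  \<open>B \<union> {v}\<close>, then the union of these \<open>3\<close>-graphs is still tight-cycle-free. There is a
  tight-cycle-free \<open>3\<close>-graph with \<open>9\<close> vertices and \<open>34 > 6/5 \<cdot> (8 choose 2)\<close> edges. Place it
  on the \<open>q\<^sup>2\<close> lines of a transversal design with \<open>8\<close> groups of size \<open>q\<close>, and use recursion
  inside the groups. The surplus \<open>34 - 6/5 \<cdot> 28 = 2/5\<close> per line is quadratic in \<open>q\<close> and pays
  for the boundedly many vertices left over because \<open>q\<close> has to be \<open>1\<close> modulo \<open>420\<close>.\<close>

section \<open>Tight cycles as vertex sequences, and transfer between vertex sets\<close>

definition tight_cycle_in :: "'a set set \<Rightarrow> nat \<Rightarrow> (nat \<Rightarrow> 'a) \<Rightarrow> bool" where
  "tight_cycle_in E l \<phi> \<longleftrightarrow> 4 \<le> l \<and> inj_on \<phi> {..<l} \<and>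
     (\<forall>i<l. {\<phi> i, \<phi> ((i + 1) mod l), \<phi> ((i + 2) mod l)} \<in> E)"

definition tight_acyclic :: "'a set set \<Rightarrow> bool" where
  "tight_acyclic E \<longleftrightarrow> (\<nexists>l \<phi>. tight_cycle_in E l \<phi>)"

definition triples_on :: "'a set \<Rightarrow> 'a set set \<Rightarrow> bool" where
  "triples_on V E \<longleftrightarrow> (\<forall>e\<in>E. e \<subseteq> V \<and> card e = 3)"

text \<open>Asking for at least \<open>m\<close> edges makes this a lower-bound predicate, so bounds
  for pieces can be added without knowing exact edge counts.\<close>

definition realizable :: "nat \<Rightarrow> nat \<Rightarrow> bool" where
  "realizable n m \<longleftrightarrow>
     (\<exists>E::nat set set. triples_on {..<n} E \<and> tight_acyclic E \<and> m \<le> card E)"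

text \<open>An isomorphism from \<open>tight_cycle l\<close> onto a subhypergraph is itself the
  vertex sequence of a cycle in \<open>E\<close>.\<close>

lemma tight_acyclic_imp_tight_cycle_free:
  assumes "tight_acyclic E"
  shows "tight_cycle_free (V, E)"
  unfolding tight_cycle_free_def
proof (intro allI impI notI)
  fix l :: nat
  assume l: "4 \<le> l"
  assume "\<exists>H. subhypergraph H (V, E) \<and> hypergraph_iso (tight_cycle l) H"
  then obtain H \<phi> where H: "snd H \<subseteq> E"
    and \<phi>: "bij_betw \<phi> {..<l} (fst H)" "snd H = (\<lambda>e. \<phi> ` e) ` snd (tight_cycle l)"
    unfolding subhypergraph_def hypergraph_iso_def by (auto simp: tight_cycle_def)
  have "{\<phi> i, \<phi> ((i + 1) mod l), \<phi> ((i + 2) mod l)} \<in> E" if "i < l" for i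
  proof -
    have "{i, (i + 1) mod l, (i + 2) mod l} \<in> snd (tight_cycle l)"
      using that by (auto simp: tight_cycle_def)
    then have "\<phi> ` {i, (i + 1) mod l, (i + 2) mod l} \<in> snd H"
      unfolding \<phi>(2) by (rule imageI)
    then show ?thesis
      using H by auto
  qed
  then have "tight_cycle_in E l \<phi>"
    using l \<phi>(1) by (auto simp: tight_cycle_in_def bij_betw_def)
  then show False
    using assms by (auto simp: tight_acyclic_def)
qed

lemma realizable_le_f3:
  assumes "realizable n m"
  shows "m \<le> f3 n"
proof -
  obtain E :: "nat set set" where E: "triples_on {..<n} E" "tight_acyclic E" "m \<le> card E"
    using assms by (auto simp: realizable_def)
  have "uniform_hypergraph 3 ({..<n}, E)"
    using E(1) by (auto simp: uniform_hypergraph_def triples_on_def)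
  then have "card E \<le> f3 n"
    unfolding f3_def
    using E(2) tight_acyclic_imp_tight_cycle_free by (intro Max_ge f3_well_defined) blast
  then show ?thesis
    using E(3) by simp
qed

text \<open>Serves to move a distinguished vertex to position 0: the common vertex when gluing, the
  smallest vertex in the search.\<close>

lemma tight_cycle_in_rotate:
  assumes "tight_cycle_in E l \<phi>"
  shows "tight_cycle_in E l (\<lambda>i. \<phi> ((i + s) mod l))"
proof -
  have l: "4 \<le> l" and inj: "inj_on \<phi> {..<l}"
    and E: "\<And>i. i < l \<Longrightarrow> {\<phi> i, \<phi> ((i + 1) mod l), \<phi> ((i + 2) mod l)} \<in> E"
    using assms by (auto simp: tight_cycle_in_def)
  have "inj_on (\<lambda>i. (i + s) mod l) {..<l}"
    by (rule inj_onI) (metis cong_def cong_add_rcancel_nat cong_less_modulus_unique_nat lessThan_iff)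
  then have "inj_on (\<phi> \<circ> (\<lambda>i. (i + s) mod l)) {..<l}"
    using l by (intro comp_inj_on inj_on_subset[OF inj]) auto
  moreover have "{\<phi> ((i + s) mod l), \<phi> (((i + 1) mod l + s) mod l),
      \<phi> (((i + 2) mod l + s) mod l)} \<in> E" for i
    using E[of "(i + s) mod l"] l by (simp add: mod_simps add_ac)
  ultimately show ?thesis
    using l by (simp add: tight_cycle_in_def comp_def)
qed

lemma tight_acyclic_image:
  assumes "tight_acyclic E" "triples_on V E" "inj_on h V"
  shows "tight_acyclic ((`) h ` E)"
  unfolding tight_acyclic_def
proof (intro notI, elim exE)
  fix l \<phi>
  assume cyc: "tight_cycle_in ((`) h ` E) l \<phi>"
  then have l: "4 \<le> l" and inj: "inj_on \<phi> {..<l}"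
    and E: "\<And>i. i < l \<Longrightarrow> {\<phi> i, \<phi> ((i + 1) mod l), \<phi> ((i + 2) mod l)} \<in> (`) h ` E"
    by (auto simp: tight_cycle_in_def)
  define g where "g = the_inv_into V h"
  have gE: "g ` e \<in> E" if "e \<in> (`) h ` E" for e
    using that assms(2,3) unfolding g_def triples_on_def
    by (auto simp: image_image subset_iff the_inv_into_f_f cong: image_cong)
  have "\<phi> i \<in> h ` V" if "i < l" for i
    using E[OF that] assms(2) unfolding triples_on_def by blast
  then have "\<phi> ` {..<l} \<subseteq> h ` V"
    by auto
  then have "inj_on (g \<circ> \<phi>) {..<l}"
    unfolding g_def by (intro comp_inj_on inj inj_on_subset[OF inj_on_the_inv_into[OF assms(3)]])
  moreover have "{g (\<phi> i), g (\<phi> ((i + 1) mod l)), g (\<phi> ((i + 2) mod l))} \<in> E" if "i < l" for i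
    using gE[OF E[OF that]] by simp
  ultimately have "tight_cycle_in E l (g \<circ> \<phi>)"
    using l by (simp add: tight_cycle_in_def)
  then show False
    using assms(1) by (auto simp: tight_acyclic_def)
qed

lemma triples_on_image:
  assumes "triples_on V E" "inj_on h V" "h ` V \<subseteq> W"
  shows "triples_on W ((`) h ` E)" and "card ((`) h ` E) = card E"
proof -
  show "triples_on W ((`) h ` E)"
    unfolding triples_on_def
  proof
    fix e'
    assume "e' \<in> (`) h ` E"
    then obtain e where e: "e' = h ` e" "e \<subseteq> V" "card e = 3"
      using assms(1) by (auto simp: triples_on_def)
    have "card (h ` e) = card e"
      by (rule card_image[OF inj_on_subset[OF assms(2) e(2)]])
    then show "e' \<subseteq> W \<and> card e' = 3"
      using e assms(3) by auto
  qed
  have "inj_on ((`) h) E"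
    by (rule inj_onI) (use assms(1,2) in \<open>simp add: triples_on_def inj_on_image_eq_iff\<close>)
  then show "card ((`) h ` E) = card E"
    by (rule card_image)
qed

text \<open>Together with \<open>realizable_onI\<close>, this lets constructions use finite vertex
  sets of any type, such as the point pairs of the design.\<close>

lemma realizable_onD:
  assumes "realizable n m" "finite W" "n \<le> card W"
  obtains E where "triples_on W E" "tight_acyclic E" "m \<le> card E"
proof -
  obtain E :: "nat set set" where E: "triples_on {..<n} E" "tight_acyclic E" "m \<le> card E"
    using assms(1) by (auto simp: realizable_def)
  obtain h where h: "inj_on h {..<n}" "h ` {..<n} \<subseteq> W"
    using card_le_inj[of "{..<n}" W] assms(2,3) by auto
  show thesis
    using that[of "(`) h ` E"] E triples_on_image[OF E(1) h] tight_acyclic_image[OF E(2,1) h(1)]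
    by simp
qed

lemma realizable_onI:
  assumes "triples_on W E" "tight_acyclic E" "m \<le> card E" "finite W" "card W \<le> n"
  shows "realizable n m"
proof -
  obtain h where h: "inj_on h W" "h ` W \<subseteq> {..<n}"
    using card_le_inj[of W "{..<n}"] assms(4,5) by auto
  show ?thesis
    unfolding realizable_def
    using assms(3) triples_on_image[OF assms(1) h] tight_acyclic_image[OF assms(2,1) h(1)]
    by metis
qed

lemma realizable_mono:
  assumes "realizable n m" "n \<le> n'"
  shows "realizable n' m"
proof -
  obtain E where "triples_on {..<n'} E" "tight_acyclic E" "m \<le> card E"
    using realizable_onD[OF assms(1), of "{..<n'}"] assms(2) by auto
  then show ?thesis
    by (auto simp: realizable_def)
qed

section \<open>Gluing 3-graphs along a common vertex\<close>

text \<open>Two consecutive edges of a tight cycle share two vertices. As \<open>v\<close> occurs at most once on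
  the cycle, rotating it to position 0 makes all the edges avoiding the last position stay within
  one block, and the last edge follows since it contains two further vertices of that block.\<close>

lemma tight_acyclic_glue:
  assumes blocks: "\<And>i j x y. \<lbrakk>i \<in> I; j \<in> I; x \<in> B i; y \<in> B i; x \<in> B j; y \<in> B j; x \<noteq> y\<rbrakk> \<Longrightarrow> i = j"
    and triples: "\<And>i. i \<in> I \<Longrightarrow> triples_on (insert v (B i)) (E i)"
    and acyclic: "\<And>i. i \<in> I \<Longrightarrow> tight_acyclic (E i)"
  shows "tight_acyclic (\<Union>i\<in>I. E i)"
  unfolding tight_acyclic_def
proof (intro notI, elim exE)
  fix l \<psi>
  assume cyc0: "tight_cycle_in (\<Union>i\<in>I. E i) l \<psi>"
  \<comment> \<open>If \<open>v\<close> is not on the cycle, any rotation works and 0 is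
    taken.\<close>
  obtain s where s: "s < l" "v \<in> \<psi> ` {..<l} \<Longrightarrow> \<psi> s = v"
  proof (cases "v \<in> \<psi> ` {..<l}")
    case True
    then show thesis
      using that by auto
  next
    case False
    then show thesis
      using that[of 0] cyc0 by (auto simp: tight_cycle_in_def)
  qed
  define \<phi> where "\<phi> = (\<lambda>i. \<psi> ((i + s) mod l))"
  have "tight_cycle_in (\<Union>i\<in>I. E i) l \<phi>"
    unfolding \<phi>_def by (rule tight_cycle_in_rotate[OF cyc0])
  then have l: "4 \<le> l" and inj: "inj_on \<phi> {..<l}"
    and "\<forall>t<l. \<exists>i\<in>I. {\<phi> t, \<phi> ((t + 1) mod l), \<phi> ((t + 2) mod l)} \<in> E i"
    by (auto simp: tight_cycle_in_def)
  then obtain \<beta> where \<beta>: "\<And>t. t < l \<Longrightarrow> \<beta> t \<in> I"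
    "\<And>t. t < l \<Longrightarrow> {\<phi> t, \<phi> ((t + 1) mod l), \<phi> ((t + 2) mod l)} \<in> E (\<beta> t)"
    by metis
  have nv: "\<phi> t \<noteq> v" if "0 < t" "t < l" for t
  proof
    assume "\<phi> t = v"
    then have "v \<in> \<psi> ` {..<l}"
      unfolding \<phi>_def using l
      by (metis imageI lessThan_iff mod_less_divisor zero_less_numeral order_less_le_trans)
    then have "\<phi> 0 = v"
      using s by (simp add: \<phi>_def)
    then show False
      using inj \<open>\<phi> t = v\<close> that l by (auto dest: inj_onD[of _ _ t 0])
  qed
  have sub: "{\<phi> t, \<phi> ((t + 1) mod l), \<phi> ((t + 2) mod l)} \<subseteq> insert v (B (\<beta> t))" if "t < l" for t
    using triples[OF \<beta>(1)[OF that], unfolded triples_on_def, THEN bspec, OF \<beta>(2)[OF that]]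
    by (rule conjunct1)
  have ne: "\<phi> a \<noteq> \<phi> b" if "a < l" "b < l" "a \<noteq> b" for a b
    using inj_onD[OF inj, of a b] that by auto
  \<comment> \<open>Edges \<open>t\<close> and \<open>t + 1\<close> share positions
    \<open>t + 1\<close> and \<open>t + 2\<close>, neither of which is 0 while
    \<open>t + 2 < l\<close>, so both vertices differ from \<open>v\<close>.\<close>
  have step: "\<beta> t = \<beta> 0" if "t + 1 < l" for t
    using that
  proof (induction t)
    case (Suc t)
    have "\<phi> (t + 1) \<in> B (\<beta> t)" "\<phi> (t + 2) \<in> B (\<beta> t)"
      using sub[of t] nv[of "t + 1"] nv[of "t + 2"] Suc.prems by auto
    moreover have "\<phi> (t + 1) \<in> B (\<beta> (t + 1))" "\<phi> (t + 2) \<in> B (\<beta> (t + 1))"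
      using sub[of "t + 1"] nv[of "t + 1"] nv[of "t + 2"] Suc.prems by auto
    ultimately have "\<beta> t = \<beta> (t + 1)"
      using blocks[OF \<beta>(1) \<beta>(1), of t "t + 1" "\<phi> (t + 1)" "\<phi> (t + 2)"] ne[of "t + 1" "t + 2"]
        Suc.prems by auto
    then show ?case
      using Suc by simp
  qed simp
  \<comment> \<open>The vertex at position 0 may be \<open>v\<close>, so the pair used is at
    positions \<open>l - 1\<close> and 1, taken from edges \<open>l - 2\<close> and 0.\<close>
  have last: "\<beta> (l - 1) = \<beta> 0"
  proof -
    have e: "(l - 2 + 1) mod l = l - 1" "(l - 1 + 1) mod l = 0" "(l - 1 + 2) mod l = 1"
    proof -
      show "(l - 2 + 1) mod l = l - 1" "(l - 1 + 1) mod l = 0"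
        using l by auto
      have "l - 1 + 2 = 1 + l"
        using l by simp
      then show "(l - 1 + 2) mod l = 1"
        using l by (simp only: mod_add_self2) simp
    qed
    have "\<phi> (l - 1) \<in> B (\<beta> 0)"
      using sub[of "l - 2"] step[of "l - 2"] nv[of "l - 1"] l unfolding e by auto
    moreover have "\<phi> 1 \<in> B (\<beta> 0)"
      using sub[of 0] nv[of 1] l by auto
    moreover have "\<phi> (l - 1) \<in> B (\<beta> (l - 1))" "\<phi> 1 \<in> B (\<beta> (l - 1))"
      using sub[of "l - 1"] nv[of "l - 1"] nv[of 1] l unfolding e by auto
    ultimately show ?thesis
      using blocks[OF \<beta>(1) \<beta>(1), of "l - 1" 0 "\<phi> 1" "\<phi> (l - 1)"] ne[of 1 "l - 1"] l by auto
  qed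
  have "\<beta> t = \<beta> 0" if "t < l" for t
    using step[of t] last that by (cases "t = l - 1") auto
  then have "tight_cycle_in (E (\<beta> 0)) l \<phi>"
    using \<beta>(2) l inj unfolding tight_cycle_in_def by metis
  then show False
    using acyclic[OF \<beta>(1)[of 0]] l by (auto simp: tight_acyclic_def)
qed

text \<open>An edge has at least two vertices other than \<open>v\<close>, and these determine its
  block; hence the edge sets are disjoint.\<close>

lemma card_glue:
  assumes "finite I"
    and blocks: "\<And>i j x y. \<lbrakk>i \<in> I; j \<in> I; x \<in> B i; y \<in> B i; x \<in> B j; y \<in> B j; x \<noteq> y\<rbrakk> \<Longrightarrow> i = j"
    and triples: "\<And>i. i \<in> I \<Longrightarrow> triples_on (insert v (B i)) (E i)"
    and fin: "\<And>i. i \<in> I \<Longrightarrow> finite (B i)"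
  shows "card (\<Union>i\<in>I. E i) = (\<Sum>i\<in>I. card (E i))"
proof (intro card_UN_disjoint assms(1) ballI impI)
  fix i
  assume "i \<in> I"
  then have "E i \<subseteq> Pow (insert v (B i))"
    using triples by (auto simp: triples_on_def)
  then show "finite (E i)"
    using fin[OF \<open>i \<in> I\<close>] by (auto intro: finite_subset)
next
  fix i j
  assume ij: "i \<in> I" "j \<in> I" "i \<noteq> j"
  have False if e: "e \<in> E i" "e \<in> E j" for e
  proof -
    have c: "card e = 3" and sub: "e \<subseteq> insert v (B i)" "e \<subseteq> insert v (B j)"
      using triples ij e by (auto simp: triples_on_def)
    obtain x y where "x \<in> e" "y \<in> e" "x \<noteq> y" "x \<noteq> v" "y \<noteq> v"
      using c unfolding card_3_iff by (metis insert_iff)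
    then show False
      using blocks[OF ij(1,2), of x y] ij(3) sub by auto
  qed
  then show "E i \<inter> E j = {}"
    by blast
qed

text \<open>The summand 1 in the vertex counts is always the same vertex \<open>v\<close>, so it is
  counted once in the union.\<close>

lemma realizable_glue:
  assumes "finite I"
    and blocks: "\<And>i j x y. \<lbrakk>i \<in> I; j \<in> I; x \<in> B i; y \<in> B i; x \<in> B j; y \<in> B j; x \<noteq> y\<rbrakk> \<Longrightarrow> i = j"
    and fin: "\<And>i. i \<in> I \<Longrightarrow> finite (B i)"
    and v: "\<And>i. i \<in> I \<Longrightarrow> v \<notin> B i"
    and real: "\<And>i. i \<in> I \<Longrightarrow> realizable (card (B i) + 1) (m i)"
  shows "realizable (card (\<Union>i\<in>I. B i) + 1) (\<Sum>i\<in>I. m i)"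
proof -
  have "\<exists>E. triples_on (insert v (B i)) E \<and> tight_acyclic E \<and> m i \<le> card E" if "i \<in> I" for i
    using realizable_onD[OF real[OF that], of "insert v (B i)"] fin[OF that] v[OF that]
    by (metis Suc_eq_plus1 card_insert_disjoint finite_insert order_refl)
  then obtain E where E: "\<And>i. i \<in> I \<Longrightarrow> triples_on (insert v (B i)) (E i)"
    "\<And>i. i \<in> I \<Longrightarrow> tight_acyclic (E i)" "\<And>i. i \<in> I \<Longrightarrow> m i \<le> card (E i)"
    by metis
  have "(\<Sum>i\<in>I. m i) \<le> card (\<Union>i\<in>I. E i)"
    using card_glue[OF assms(1) blocks E(1) fin] E(3) by (simp add: sum_mono)
  moreover have "tight_acyclic (\<Union>i\<in>I. E i)"
    by (rule tight_acyclic_glue[OF blocks E(1,2)])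
  moreover have "triples_on (insert v (\<Union>i\<in>I. B i)) (\<Union>i\<in>I. E i)"
    using E(1) unfolding triples_on_def by blast
  moreover have "finite (\<Union>i\<in>I. B i)" "v \<notin> (\<Union>i\<in>I. B i)"
    using assms(1) fin v by auto
  ultimately show ?thesis
    by (intro realizable_onI[of "insert v (\<Union>i\<in>I. B i)"]) auto
qed

section \<open>The transversal design with 8 groups\<close>

text \<open>The groups \<open>Inl i\<close> and the lines \<open>Inr (a, b)\<close> of the transversal design.\<close>

fun td_block :: "nat \<Rightarrow> nat + nat \<times> nat \<Rightarrow> (nat \<times> nat) set" where
  "td_block q (Inl i) = {i} \<times> {..<q}"
| "td_block q (Inr (a, b)) = (\<lambda>i. (i, (a + b * i) mod q)) ` {..<8}"

text \<open>420 is the least common multiple of 1, ..., 7, so \<open>q\<close> is 1 modulo each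
  possible \<open>d\<close>.\<close>

lemma coprime_of_less_8:
  assumes "0 < d" "d < (8::nat)" "[q = 1] (mod 420)"
  shows "coprime d q"
proof -
  have "d \<in> {1, 2, 3, 4, 5, 6, 7}"
    using assms(1,2) by auto
  then have "d dvd 420"
    by auto
  then have "[q = 1] (mod d)"
    using assms(3) cong_dvd_modulus_nat by blast
  then show ?thesis
    by (metis cong_imp_coprime cong_sym coprime_1_left coprime_commute)
qed

text \<open>Subtracting the congruences gives \<open>(b - b') * (j - i)\<close> = 0 modulo
  \<open>q\<close>, and \<open>j - i\<close>, lying between 1 and 7, is invertible.\<close>

lemma lines_meet_once:
  fixes q a b a' b' i j :: nat
  assumes q: "[q = 1] (mod 420)" and ij: "i < j" "j < 8"
    and less: "a < q" "b < q" "a' < q" "b' < q"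
    and meet: "[a + b * i = a' + b' * i] (mod q)" "[a + b * j = a' + b' * j] (mod q)"
  shows "a = a' \<and> b = b'"
proof -
  define d where "d = j - i"
  have d: "j = i + d" "0 < d" "d < 8"
    using ij by (simp_all add: d_def)
  \<comment> \<open>The subtraction is done by cancelling equal summands, as \<open>-\<close>
    truncates on \<open>nat\<close>.\<close>
  have "[(a + b * i) + b * d = (a' + b' * i) + b' * d] (mod q)"
    using meet(2) by (simp add: d(1) algebra_simps)
  moreover have "[(a + b * i) + b' * d = (a' + b' * i) + b' * d] (mod q)"
    by (rule cong_add[OF meet(1) cong_refl])
  ultimately have "[(a + b * i) + b * d = (a + b * i) + b' * d] (mod q)"
    using cong_sym cong_trans by blast
  then have "[b * d = b' * d] (mod q)"
    by (simp only: cong_add_lcancel_nat)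
  then have "[b = b'] (mod q)"
    by (simp only: cong_mult_rcancel_nat[OF coprime_of_less_8[OF d(2,3) q]])
  then have "b = b'"
    using less cong_less_modulus_unique_nat by blast
  then have "[a = a'] (mod q)"
    using meet(1) by (simp only: cong_add_rcancel_nat)
  then have "a = a'"
    using less cong_less_modulus_unique_nat by blast
  then show ?thesis
    using \<open>b = b'\<close> by blast
qed

text \<open>Distinct groups are disjoint, a line has one point in each group, and two lines are
  handled by \<open>lines_meet_once\<close>.\<close>

lemma td_blocks_linear:
  assumes q: "[q = 1] (mod 420)"
    and s: "s \<in> {..<8} <+> {..<q} \<times> {..<q}" "t \<in> {..<8} <+> {..<q} \<times> {..<q}"
    and x: "x \<in> td_block q s" "y \<in> td_block q s" "x \<in> td_block q t" "y \<in> td_block q t" "x \<noteq> y"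
  shows "s = t"
proof -
  have line: "a = a' \<and> b = b'"
    if p: "a < q" "b < q" "a' < q" "b' < q" "x \<in> td_block q (Inr (a, b))"
      "y \<in> td_block q (Inr (a, b))" "x \<in> td_block q (Inr (a', b'))"
      "y \<in> td_block q (Inr (a', b'))" for a b a' b'
  proof -
    obtain i j where "i < 8" "x = (i, (a + b * i) mod q)" "j < 8" "y = (j, (a + b * j) mod q)"
      using p(5,6) by auto
    moreover from this have "i \<noteq> j" "[a + b * i = a' + b' * i] (mod q)"
      "[a + b * j = a' + b' * j] (mod q)"
      using p(7,8) x(5) by (auto simp: cong_def)
    ultimately show ?thesis
      using lines_meet_once[OF q, of i j a b a' b'] lines_meet_once[OF q, of j i a b a' b'] p
      by (meson linorder_neqE_nat)
  qed
  show ?thesis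
  proof (cases s)
    case (Inl i)
    then show ?thesis
      using s x by (cases t) auto
  next
    case (Inr p)
    show ?thesis
    proof (cases t)
      case (Inl j)
      then show ?thesis
        using \<open>s = Inr p\<close> s x by (cases p) auto
    next
      case (Inr p')
      obtain a b a' b' where "p = (a, b)" "p' = (a', b')"
        by (cases p, cases p')
      then show ?thesis
        using line[of a b a' b'] \<open>s = Inr p\<close> \<open>t = Inr p'\<close> s x by auto
    qed
  qed
qed

text \<open>The groups alone cover all \<open>8 * q\<close> points. Each of the
  \<open>q\<^sup>2\<close> lines has 8 points and, with the common vertex, carries a 9-vertex
  graph.\<close>

lemma realizable_transversal_design:
  assumes q: "[q = 1] (mod 420)" and m: "realizable (q + 1) m" and g: "realizable 9 g"
  shows "realizable (8 * q + 1) (8 * m + g * q\<^sup>2)"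
proof -
  define I :: "(nat + nat \<times> nat) set" where "I = {..<8} <+> {..<q} \<times> {..<q}"
  have "0 < q"
    using q by (auto simp: cong_def intro: Nat.gr0I)
  have un: "(\<Union>s\<in>I. td_block q s) = {..<8} \<times> {..<q}"
    using \<open>0 < q\<close> by (auto simp: I_def)
  have line: "card (td_block q (Inr p)) = 8" for p
    by (cases p) (auto simp: card_image inj_on_def)
  have "realizable (card (\<Union>s\<in>I. td_block q s) + 1)
      (\<Sum>s\<in>I. case s of Inl _ \<Rightarrow> m | Inr _ \<Rightarrow> g)"
  proof (rule realizable_glue)
    show "finite I"
      by (simp add: I_def)
    show "s = t" if "s \<in> I" "t \<in> I" "x \<in> td_block q s" "y \<in> td_block q s" "x \<in> td_block q t"
      "y \<in> td_block q t" "x \<noteq> y" for s t x y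
      using td_blocks_linear[OF q] that unfolding I_def by blast
    show "finite (td_block q s)" for s
      by (cases "(q, s)" rule: td_block.cases) auto
    \<comment> \<open>The common vertex gets first coordinate 8, outside the groups 0, ...,
      7.\<close>
    show "(8, 0) \<notin> td_block q s" if "s \<in> I" for s
      using that by (auto simp: I_def)
    show "realizable (card (td_block q s) + 1) (case s of Inl _ \<Rightarrow> m | Inr _ \<Rightarrow> g)" for s
      using m g line by (cases s) (simp_all del: td_block.simps(2))
  qed
  then show ?thesis
    unfolding un by (simp add: I_def sum.Plus power2_eq_square mult.commute)
qed

section \<open>The 9-vertex gadget and its verification\<close>

text \<open>Found by computer search. Vertices are numbered so that the search below stays small.\<close>

definition gadget :: "nat list list" where
  "gadget =
   [[0,1,2], [0,1,3], [0,1,4], [0,1,5], [0,1,7], [0,1,8], [0,2,3], [0,2,6],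
    [0,2,8], [0,3,4], [0,3,5], [0,3,6], [0,3,7], [0,4,6], [0,4,8], [0,5,6],
    [0,5,8], [0,6,7], [0,6,8], [0,7,8], [1,2,6], [1,3,8], [1,4,6], [1,5,6],
    [1,6,7], [2,3,4], [2,3,5], [2,4,5], [2,4,7], [2,5,7], [2,7,8], [3,4,7],
    [3,6,8], [4,5,8]]"

text \<open>Depth-first search for a tight cycle on \<open>{..<9}\<close> starting with \<open>s\<close>, \<open>y\<close>, whose smallest
  vertex is \<open>s\<close>: \<open>a\<close>, \<open>b\<close> are the last two vertices and \<open>us\<close> all the vertices of the current path,
  and \<open>n\<close> is a recursion bound.\<close>

fun no_cycle_from ::
    "(nat \<Rightarrow> nat \<Rightarrow> nat \<Rightarrow> bool) \<Rightarrow> nat \<Rightarrow> nat \<Rightarrow> nat \<Rightarrow> nat \<Rightarrow> nat \<Rightarrow> nat list \<Rightarrow> bool" where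
  "no_cycle_from P 0 s y a b us \<longleftrightarrow> True"
| "no_cycle_from P (Suc n) s y a b us \<longleftrightarrow>
     (if 4 \<le> length us then (if P a b s then \<not> P b s y else True) else True) \<and>
     list_all (\<lambda>c. if c \<in> set us then True else if P a b c
       then no_cycle_from P n s y b c (c # us) else True) [Suc s..<9]"

text \<open>The search can follow \<phi> itself up to the closing test. The bound
  \<open>l < n + t + 2\<close> ensures that the recursion does not stop first: for
  \<open>n = 0\<close> it contradicts \<open>t + 2 \<le> l\<close>.\<close>

lemma no_cycle_from_sound:
  assumes cyc: "tight_cycle_in E l \<phi>"
    and P: "\<And>a b c. {a, b, c} \<in> E \<Longrightarrow> P a b c"
    and less: "\<And>i. i < l \<Longrightarrow> \<phi> i < 9"
    and min: "\<And>i. \<lbrakk>0 < i; i < l\<rbrakk> \<Longrightarrow> \<phi> 0 < \<phi> i"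
  shows "\<lbrakk>t + 2 \<le> l; l < n + t + 2; set us = \<phi> ` {..t + 1}; length us = t + 2\<rbrakk>
    \<Longrightarrow> \<not> no_cycle_from P n (\<phi> 0) (\<phi> 1) (\<phi> t) (\<phi> (t + 1)) us"
proof (induction n arbitrary: t us)
  case (Suc n)
  have l: "4 \<le> l" and inj: "inj_on \<phi> {..<l}"
    and E: "\<And>i. i < l \<Longrightarrow> {\<phi> i, \<phi> ((i + 1) mod l), \<phi> ((i + 2) mod l)} \<in> E"
    using cyc by (auto simp: tight_cycle_in_def)
  show ?case
  proof (cases "t + 2 = l")
    case True
    \<comment> \<open>The edges at positions \<open>l - 2\<close> and \<open>l - 1\<close> are the
      two that the closing test inspects.\<close>
    have "Suc t mod l = Suc t" "(t + 2) mod l = 0" "(Suc t + 1) mod l = 0" "(Suc t + 2) mod l = 1"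
      using True l by (auto simp: mod_Suc)
    then have "P (\<phi> t) (\<phi> (t + 1)) (\<phi> 0)" "P (\<phi> (t + 1)) (\<phi> 0) (\<phi> 1)"
      using P[OF E[of t]] P[OF E[of "Suc t"]] True by auto
    then show ?thesis
      using Suc.prems True l by auto
  next
    case False
    then have t: "t + 2 < l"
      using Suc.prems by simp
    have "\<phi> (t + 2) \<notin> \<phi> ` {..t + 1}"
      using t inj by (auto dest!: inj_onD)
    moreover have "P (\<phi> t) (\<phi> (t + 1)) (\<phi> (t + 2))"
      using P[OF E[of t]] t by simp
    moreover have "\<phi> (t + 2) \<in> set [Suc (\<phi> 0)..<9]"
      using less[OF t] min[OF _ t] by simp
    moreover have "\<not> no_cycle_from P n (\<phi> 0) (\<phi> 1) (\<phi> (t + 1)) (\<phi> (t + 2)) (\<phi> (t + 2) # us)"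
    proof -
      have "set (\<phi> (t + 2) # us) = \<phi> ` {..t + 1 + 1}"
        using Suc.prems by (simp add: atMost_Suc)
      then show ?thesis
        using Suc.IH[of "t + 1" "\<phi> (t + 2) # us"] Suc.prems t by simp
    qed
    ultimately show ?thesis
      using Suc.prems by (auto simp: list_all_iff simp del: set_upt)
  qed
qed simp

text \<open>Edges are stored as sorted lists, so sorting decides membership of an unordered triple.
  Recursion bound 8 covers cycles of length up to 9.\<close>

lemma gadget_search:
  "list_all (\<lambda>s. list_all (\<lambda>y. no_cycle_from (\<lambda>a b c. List.member gadget (sort [a, b, c]))
     8 s y s y [y, s]) [Suc s..<9]) [0..<9]"
  by code_simp

text \<open>Strict sortedness makes each list recoverable from its set; both the membership test and
  the edge count rely on this.\<close>

lemma gadget_wf: "list_all (\<lambda>e. length e = 3 \<and> sorted_wrt (<) e \<and> list_all (\<lambda>x. x < 9) e) gadget"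
  by (simp add: gadget_def)

lemma tight_acyclic_gadget: "tight_acyclic (set ` set gadget)"
  unfolding tight_acyclic_def
proof (intro notI, elim exE)
  fix l \<psi>
  assume cyc0: "tight_cycle_in (set ` set gadget) l \<psi>"
  then have l: "4 \<le> l" and E: "\<And>i. i < l \<Longrightarrow> \<exists>e\<in>set gadget. \<psi> i \<in> set e"
    by (auto simp: tight_cycle_in_def)
  obtain s where s: "s < l" "\<And>i. i < l \<Longrightarrow> \<psi> s \<le> \<psi> i"
    using arg_min_nat_lemma[of "\<lambda>i. i < l" 0 \<psi>] l
    by (metis order_less_le_trans zero_less_numeral)
  define \<phi> where "\<phi> = (\<lambda>i. \<psi> ((i + s) mod l))"
  have cyc: "tight_cycle_in (set ` set gadget) l \<phi>"
    unfolding \<phi>_def by (rule tight_cycle_in_rotate[OF cyc0])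
  then have inj: "inj_on \<phi> {..<l}"
    by (simp add: tight_cycle_in_def)
  have less: "\<phi> i < 9" for i
    using E[of "(i + s) mod l"] gadget_wf l by (auto simp: \<phi>_def list_all_iff)
  have min: "\<phi> 0 < \<phi> i" if "0 < i" "i < l" for i
  proof -
    have "\<phi> 0 \<le> \<phi> i"
      using s l by (simp add: \<phi>_def)
    moreover have "\<phi> 0 \<noteq> \<phi> i"
      using inj that by (auto dest: inj_onD[of _ _ 0 i])
    ultimately show ?thesis
      by simp
  qed
  have P: "List.member gadget (sort [a, b, c])" if abc: "{a, b, c} \<in> set ` set gadget" for a b c
  proof -
    obtain e where e: "e \<in> set gadget" "set e = {a, b, c}"
      using abc by auto
    then have "length e = 3" "sorted e" "distinct e"
      using gadget_wf by (auto simp: list_all_iff strict_sorted_iff)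
    moreover from this have "card {a, b, c} = 3"
      using e(2) distinct_card by metis
    then have "distinct [a, b, c]"
      by (auto simp: card_insert_if split: if_splits)
    ultimately have "e = sort [a, b, c]"
      using e(2) by (intro sorted_distinct_set_unique) auto
    then show ?thesis
      using e(1) by simp
  qed
  have "l \<le> 9"
    using card_inj_on_le[OF inj, of "{..<9}"] less by auto
  then have "\<not> no_cycle_from (\<lambda>a b c. List.member gadget (sort [a, b, c])) 8
      (\<phi> 0) (\<phi> 1) (\<phi> 0) (\<phi> 1) [\<phi> 1, \<phi> 0]"
    using no_cycle_from_sound[OF cyc P less min, where t = 0 and n = 8 and us = "[\<phi> 1, \<phi> 0]"] l
    by (auto simp: atMost_Suc)
  moreover have "\<phi> 0 \<in> set [0..<9]" "\<phi> 1 \<in> set [Suc (\<phi> 0)..<9]"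
    using less[of 0] less[of 1] min[of 1] l by auto
  ultimately show False
    using gadget_search unfolding list_all_iff by blast
qed

lemma realizable_gadget: "realizable 9 34"
proof -
  have "triples_on {..<9} (set ` set gadget)"
    using gadget_wf by (auto simp: triples_on_def list_all_iff strict_sorted_iff distinct_card)
  moreover have "card (set ` set gadget) = 34"
  proof -
    have "inj_on set (set gadget)"
      using gadget_wf by (auto simp: inj_on_def list_all_iff strict_sorted_iff
          intro: sorted_distinct_set_unique)
    moreover have "distinct gadget" "length gadget = 34"
      by (simp_all add: gadget_def)
    ultimately show ?thesis
      by (simp add: card_image distinct_card)
  qed
  ultimately show ?thesis
    using tight_acyclic_gadget by (auto simp: realizable_def)
qed

section \<open>Recursion and the final bound\<close>

text \<open>The coefficient 3/5 is half of 6/5. Up to \<open>10 ^ 6\<close> the bound is not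
  positive, so the empty graph suffices; beyond that the design reduces \<open>N\<close> to
  \<open>q\<close>.\<close>

lemma realizable_quadratic:
  "\<exists>m. realizable (N + 1) m \<and> 3 / 5 * (real N)\<^sup>2 - 10 ^ 6 * real N \<le> real m"
proof (induction N rule: less_induct)
  case (less N)
  show ?case
  proof (cases "N \<le> 10 ^ 6")
    case True
    have "realizable (N + 1) 0"
      by (auto simp: realizable_def triples_on_def tight_acyclic_def tight_cycle_in_def
          intro!: exI[of _ "{}"] exI[of _ 0])
    moreover have "real N * real N \<le> 10 ^ 6 * real N"
      using True by (intro mult_right_mono) auto
    then have "3 / 5 * (real N)\<^sup>2 - 10 ^ 6 * real N \<le> real 0"
      by (simp add: power2_eq_square)
    ultimately show ?thesis
      by blast
  next
    case False
    \<comment> \<open>As \<open>8 * q = 3360 * k + 8\<close>, this is the largest admissible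
      \<open>q\<close> with \<open>8 * q \<le> N\<close>; it leaves fewer than 3360 vertices
      over.\<close>
    define k where "k = (N - 8) div 3360"
    define q where "q = 420 * k + 1"
    define s where "s = N - 8 * q"
    have "N - 8 = 3360 * k + (N - 8) mod 3360"
      by (simp add: k_def)
    then have "s = (N - 8) mod 3360" and N: "N = 8 * q + s"
      using False by (simp_all add: s_def q_def)
    then have s: "s < 3360"
      by simp
    have q: "[q = 1] (mod 420)"
      by (simp add: q_def cong_def mod_simps)
    have large: "10 ^ 5 \<le> real q"
    proof -
      have "10 ^ 5 \<le> q"
        using N s False by simp
      then show ?thesis
        by (metis of_nat_le_iff of_nat_numeral of_nat_power)
    qed
    obtain m where m: "realizable (q + 1) m" "3 / 5 * (real q)\<^sup>2 - 10 ^ 6 * real q \<le> real m"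
      using less[of q] N large by auto
    have "realizable (N + 1) (8 * m + 34 * q\<^sup>2)"
      by (rule realizable_mono[OF realizable_transversal_design[OF q m(1) realizable_gadget]])
        (simp add: N)
    moreover have "3 / 5 * (real N)\<^sup>2 - 10 ^ 6 * real N \<le> real (8 * m + 34 * q\<^sup>2)"
    proof -
      \<comment> \<open>The surplus is \<open>2/5 * q\<^sup>2\<close>, at least
        \<open>40000 * q\<close>. It covers the cross term \<open>48/5 * q * s\<close>, at most
        \<open>32256 * q\<close>; the term in \<open>s\<^sup>2\<close> is absorbed by
        \<open>10 ^ 6 * s\<close>.\<close>
      have "real q * real s \<le> real q * 3360" "real s * real s \<le> 3360 * real s"
        "10 ^ 5 * real q \<le> real q * real q"
        using s large by (intro mult_left_mono mult_right_mono; simp)+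
      then have "3 / 5 * (real N)\<^sup>2 - 10 ^ 6 * real N
          \<le> 8 * (3 / 5 * (real q)\<^sup>2 - 10 ^ 6 * real q) + 34 * (real q)\<^sup>2"
        by (simp add: N power2_eq_square algebra_simps)
      then show ?thesis
        using m(2) by simp
    qed
    ultimately show ?thesis
      by blast
  qed
qed

theorem theorem3p2:
  shows "\<exists>C::real. C > 0 \<and>
    (\<forall>\<^sub>F n in sequentially.
       real (f3 n) \<ge> (1 + 1 / 5) * real ((n - 1) choose 2) - C * real n)"
proof (intro exI conjI)
  show "(0::real) < 10 ^ 6"
    by simp
  show "\<forall>\<^sub>F n in sequentially.
      real (f3 n) \<ge> (1 + 1 / 5) * real ((n - 1) choose 2) - 10 ^ 6 * real n"
  proof (rule eventually_sequentiallyI[of 1])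
    fix n :: nat
    assume "1 \<le> n"
    then obtain N where n: "n = N + 1"
      by (metis add.commute le_Suc_ex)
    obtain m where m: "realizable n m" "3 / 5 * (real N)\<^sup>2 - 10 ^ 6 * real N \<le> real m"
      using realizable_quadratic[of N] n by auto
    \<comment> \<open>This turns 6/5 of the binomial coefficient into at most
      \<open>3/5 * N\<^sup>2\<close>.\<close>
    have "2 * (N choose 2) \<le> N * (N - 1)"
      by (simp only: choose_two times_div_less_eq_dividend)
    also have "\<dots> \<le> N\<^sup>2"
      by (simp add: power2_eq_square)
    finally have "2 * (N choose 2) \<le> N\<^sup>2" .
    then have "2 * real (N choose 2) \<le> (real N)\<^sup>2"
      by (metis of_nat_le_iff of_nat_mult of_nat_numeral of_nat_power)
    moreover have "real m \<le> real (f3 n)"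
      using realizable_le_f3[OF m(1)] by simp
    ultimately show "real (f3 n) \<ge> (1 + 1 / 5) * real ((n - 1) choose 2) - 10 ^ 6 * real n"
      using m(2) by (simp add: n)
  qed
qed

end
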